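(* Let $d\ge 1$ be an integer, let $\alpha,\lambda>0$, and let $(W_x)_{x\in\mathbb{Z}^d}$ be i.i.d. non-negative random variables with common distribution function $F$ and with $\mathbb{P}(W_0>0)>0$. Consider the random graph on $\mathbb{Z}^d$ in which, conditionally on $(W_x)_{x\in\mathbb{Z}^d}$, the edges between distinct vertices $x,y$ are independently present with probability $p_{xy}=1-\exp\{-\lambda W_xW_y/|x-y|^{\alpha}\}$, and let $D_0$ be the degree of the vertex $0$. Then $$\mathbb{P}(D_0=\infty\mid W_0>0)=1$$ in each of the following two cases: (i) $\alpha\le d$; (ii) $\alpha>d$ and there exist $c>0$ and $\tau>1$ such that $1-F(w)\ge c\,w^{-(\tau-1)}$ for all $w\ge 1$ and such that $\gamma:=\alpha(\tau-1)/d\le 1$.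
   Context: $|\cdot|$ denotes the Euclidean norm on $\mathbb{R}^d$. The graph has vertex set $\mathbb{Z}^d$, and each unordered pair of distinct vertices is a potential edge. The degree $D_0\in\{0,1,2,\dots\}\cup\{\infty\}$ is the number of vertices $y\ne 0$ for which the edge $(0,y)$ is present. *)

theory Defs
  imports "HOL-Probability.Probability" "HOL-Library.Extended_Nat"
begin

definition lattice_dist :: "int ^ 'd \<Rightarrow> int ^ 'd \<Rightarrow> real" where
  "lattice_dist x y = norm ((\<chi> i. real_of_int (x $ i - y $ i)) :: real ^ 'd)"

text \<open>A simple undirected graph is given by its edge set, and an edge is an unordered pair.\<close>

definition potential_edges :: "'v set set" where
  "potential_edges = {{x, y} | x y. x \<noteq> y}"

definition vertex_degree :: "'v set set \<Rightarrow> 'v \<Rightarrow> enat" where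
  "vertex_degree E x = (let N = {y. y \<noteq> x \<and> {x, y} \<in> E} in if finite N then enat (card N) else \<infinity>)"

definition sigma_generated :: "'a measure \<Rightarrow> ('v \<Rightarrow> 'a \<Rightarrow> real) \<Rightarrow> 'a measure" where
  "sigma_generated M W =
     vimage_algebra (space M) (\<lambda>\<omega> x. W x \<omega>) (\<Pi>\<^sub>M x\<in>UNIV. borel)"

definition cond_event_prob :: "'a measure \<Rightarrow> 'a measure \<Rightarrow> 'a set \<Rightarrow> 'a \<Rightarrow> real" where
  "cond_event_prob M \<F> A = real_cond_exp M \<F> (indicator A)"

text \<open>The conditional analogue of \<^const>\<open>prob_space.indep_events\<close>. The index set \<open>J\<close> is
  nonempty there too, because \<open>\<Inter>j\<in>{}. A j\<close> is the whole type rather than \<open>space M\<close>.\<close>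

definition cond_indep_events ::
  "'a measure \<Rightarrow> 'a measure \<Rightarrow> ('i \<Rightarrow> 'a set) \<Rightarrow> 'i set \<Rightarrow> bool" where
  "cond_indep_events M \<F> A I \<longleftrightarrow>
     (\<forall>i\<in>I. A i \<in> sets M) \<and>
     (\<forall>J\<subseteq>I. J \<noteq> {} \<longrightarrow> finite J \<longrightarrow>
        (AE \<omega> in M. cond_event_prob M \<F> (\<Inter>j\<in>J. A j) \<omega> =
                    (\<Prod>j\<in>J. cond_event_prob M \<F> (A j) \<omega>)))"

text \<open>\<open>G \<omega>\<close> is the edge set of the random graph in the outcome \<open>\<omega>\<close>.\<close>

definition scale_free_percolation ::
  "'a measure \<Rightarrow> (int ^ 'd \<Rightarrow> 'a \<Rightarrow> real) \<Rightarrow> ('a \<Rightarrow> (int ^ 'd) set set) \<Rightarrow> real \<Rightarrow> real \<Rightarrow> bool" where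
  "scale_free_percolation M W G \<alpha> lam \<longleftrightarrow>
     (\<forall>\<omega>\<in>space M. G \<omega> \<subseteq> potential_edges) \<and>
     cond_indep_events M (sigma_generated M W) (\<lambda>e. {\<omega> \<in> space M. e \<in> G \<omega>}) potential_edges \<and>
     (\<forall>x y. x \<noteq> y \<longrightarrow>
        (AE \<omega> in M. cond_event_prob M (sigma_generated M W) {\<omega> \<in> space M. {x, y} \<in> G \<omega>} \<omega> =
           1 - exp (- (lam * W x \<omega> * W y \<omega> / lattice_dist x y powr \<alpha>))))"

end

theory Submission
  imports Defs "HOL-Real_Asymp.Real_Asymp"
begin

text \<open>
  The exponential form of the connection probabilities makes the conditional probability that \<open>0\<close> has
  no neighbour in a finite set \<open>J\<close> of other vertices, given all the weights, exactly
  \<open>exp (- lam * W 0 * (\<Sum>y\<in>J. W y / |y| powr \<alpha>))\<close>.  On the event \<open>\<delta> \<le> W 0\<close> it only grows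
  when \<open>W 0\<close> is replaced by \<open>\<delta>\<close>.  The bound obtained involves only the independent weights in \<open>J\<close>,
  so its expectation is a product of Laplace transforms \<open>E (exp (- s * W y / |y| powr \<alpha>))\<close> with
  \<open>s = lam * \<delta>\<close> (\<open>prob_no_edge_le\<close>).

  The two cases of the theorem meet in one estimate (\<open>laplace_lattice_bound\<close>): each of these
  transforms is at most \<open>exp (- \<kappa> * |y| powr -d)\<close> for some \<open>\<kappa> > 0\<close>.  If \<open>\<alpha> \<le> d\<close>, a typical positive
  weight already lowers the transform by an amount of order \<open>|y| powr -\<alpha> \<ge> |y| powr -d\<close>.  In the
  heavy-tailed case the integrand is at most \<open>exp (- s)\<close> when \<open>W y > |y| powr \<alpha>\<close>, an event of
  probability at least \<open>c * |y| powr (- \<alpha> * (\<tau> - 1)) \<ge> c * |y| powr -d\<close> because \<open>\<gamma> \<le> 1\<close>.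

  Since \<open>\<Sum>y\<noteq>0. |y| powr -d\<close> diverges over the lattice (\<open>dyadic_blocks_mass\<close>), the product over the
  dyadic blocks with index from \<open>m\<close> to \<open>n\<close> tends to \<open>0\<close> as \<open>n\<close> grows.  So for every \<open>m\<close> and every \<open>\<delta> > 0\<close>, almost
  surely on \<open>\<delta> \<le> W 0\<close>, some block beyond \<open>m\<close> contains a neighbour of \<open>0\<close>; letting \<open>m\<close> and \<open>1 / \<delta>\<close> range
  over countable sets gives infinitely many neighbours almost surely on \<open>W 0 > 0\<close>
  (\<open>AE_infinite_degree\<close>).
\<close>

section \<open>Dyadic blocks of the lattice\<close>

text \<open>Only one orthant is used: it already carries divergent mass, and there the blocks are cubes, whose
  cardinality is immediate and which are pairwise disjoint.\<close>

definition dyadic_block :: "nat \<Rightarrow> (int ^ 'd) set" where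
  "dyadic_block k = {y. \<forall>i. y $ i \<in> {2 ^ k..<2 ^ Suc k}}"

lemma card_dyadic_block:
  "finite (dyadic_block k :: (int ^ 'd) set)"
  "card (dyadic_block k :: (int ^ 'd) set) = (2 ^ k) ^ CARD('d)"
proof -
  have bij: "bij_betw (\<lambda>y :: int ^ 'd. vec_nth y) (dyadic_block k)
               (\<Pi>\<^sub>E i\<in>UNIV. {2 ^ k..<2 ^ Suc k})"
    by (rule bij_betw_byWitness[where f' = "\<lambda>f. \<chi> i. f i"])
       (auto simp: dyadic_block_def)
  show "finite (dyadic_block k :: (int ^ 'd) set)"
    using bij_betw_finite[OF bij] by (auto intro!: finite_PiE)
  show "card (dyadic_block k :: (int ^ 'd) set) = (2 ^ k) ^ CARD('d)"
    using bij_betw_same_card[OF bij] by (simp add: card_PiE nat_power_eq)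
qed

lemma disjoint_dyadic_block:
  assumes "j \<noteq> k"
  shows "dyadic_block j \<inter> (dyadic_block k :: (int ^ 'd) set) = {}"
proof -
  have "dyadic_block i \<inter> (dyadic_block l :: (int ^ 'd) set) = {}" if "i < l" for i l
  proof -
    have "(2::int) ^ Suc i \<le> 2 ^ l"
      using that by (intro power_increasing) auto
    then have "y \<notin> dyadic_block l" if "y \<in> dyadic_block i" for y :: "int ^ 'd"
      using that unfolding dyadic_block_def
      by (metis (mono_tags, lifting) atLeastLessThan_iff linorder_not_le mem_Collect_eq order_trans)
    then show ?thesis
      by blast
  qed
  with assms show ?thesis
    by (metis Int_commute linorder_neqE_nat)
qed

lemma zero_notin_dyadic_block: "0 \<notin> dyadic_block k"
  by (auto simp: dyadic_block_def not_le)

lemma one_le_lattice_dist_zero: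
  fixes y :: "int ^ 'd"
  assumes "y \<noteq> 0"
  shows "1 \<le> lattice_dist 0 y"
proof -
  obtain i where "y $ i \<noteq> 0"
    using assms by (auto simp: vec_eq_iff)
  then have "1 \<le> \<bar>real_of_int (0 $ i - y $ i)\<bar>"
    by simp
  also have "\<dots> \<le> lattice_dist 0 y"
    using component_le_norm_cart[of "(\<chi> i. real_of_int (0 $ i - y $ i)) :: real ^ 'd" i]
    by (simp add: lattice_dist_def)
  finally show ?thesis .
qed

lemma lattice_dist_zero_dyadic_block_le:
  fixes y :: "int ^ 'd"
  assumes "y \<in> dyadic_block k"
  shows "lattice_dist 0 y \<le> 2 * real CARD('d) * 2 ^ k"
proof -
  have "lattice_dist 0 y \<le> (\<Sum>i\<in>UNIV. \<bar>real_of_int (y $ i)\<bar>)"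
    using norm_le_l1_cart[of "(\<chi> i. real_of_int (0 $ i - y $ i)) :: real ^ 'd"]
    by (simp add: lattice_dist_def)
  also have "\<dots> \<le> (\<Sum>i\<in>(UNIV :: 'd set). 2 * 2 ^ k)"
  proof (rule sum_mono)
    fix i :: 'd
    have "0 \<le> y $ i" "y $ i \<le> 2 * 2 ^ k"
      using assms by (auto simp: dyadic_block_def intro: less_imp_le order_trans[of 0 "2 ^ k"])
    then have "real_of_int (y $ i) \<le> real_of_int (2 * 2 ^ k)"
      by (intro of_int_le_iff[THEN iffD2])
    with \<open>0 \<le> y $ i\<close> show "\<bar>real_of_int (y $ i)\<bar> \<le> 2 * 2 ^ k"
      by simp
  qed
  finally show ?thesis
    by (simp add: mult_ac)
qed

text \<open>The exponent \<open>-d\<close> is the critical one: a block has \<open>2 ^ (k * d)\<close> points at distance of order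
  \<open>2 ^ k\<close>, so its contribution is bounded below independently of \<open>k\<close>.  Hence \<open>\<Sum>y\<noteq>0. |y| powr -d\<close> diverges, at a
  linear rate in the number of blocks.\<close>

lemma dyadic_block_mass:
  "(\<Sum>y\<in>(dyadic_block k :: (int ^ 'd) set). lattice_dist 0 y powr - real CARD('d))
     \<ge> (2 * real CARD('d)) powr - real CARD('d)"
proof -
  let ?d = "real CARD('d)"
  let ?B = "dyadic_block k :: (int ^ 'd) set"
  have "(2 * ?d) powr - ?d = real (card ?B) * (2 * ?d * 2 ^ k) powr - ?d"
  proof -
    have "(2 * ?d * 2 ^ k) powr - ?d = (2 * ?d) powr - ?d * (2 ^ k) powr - ?d"
      by (simp add: powr_mult)
    moreover have "((2::real) ^ k) powr - ?d = inverse ((2 ^ k) ^ CARD('d))"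
      by (simp add: powr_minus powr_realpow)
    ultimately show ?thesis
      by (simp add: card_dyadic_block)
  qed
  also have "\<dots> = (\<Sum>y\<in>?B. (2 * ?d * 2 ^ k) powr - ?d)"
    by simp
  also have "\<dots> \<le> (\<Sum>y\<in>?B. lattice_dist 0 y powr - ?d)"
  proof (rule sum_mono)
    fix y assume y: "y \<in> ?B"
    then have "y \<noteq> 0"
      using zero_notin_dyadic_block by metis
    then have "0 < lattice_dist 0 y"
      using one_le_lattice_dist_zero[of y] by simp
    with lattice_dist_zero_dyadic_block_le[OF y]
    show "(2 * ?d * 2 ^ k) powr - ?d \<le> lattice_dist 0 y powr - ?d"
      by (intro powr_mono2') auto
  qed
  finally show ?thesis .
qed

lemma dyadic_blocks_mass:
  fixes m n :: nat
  defines "J \<equiv> \<Union>k\<in>{m..<n}. (dyadic_block k :: (int ^ 'd) set)"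
  shows "(\<Sum>y\<in>J. lattice_dist 0 y powr - real CARD('d))
     \<ge> real (n - m) * (2 * real CARD('d)) powr - real CARD('d)"
proof -
  have "(\<Sum>y\<in>J. lattice_dist 0 y powr - real CARD('d)) =
      (\<Sum>k\<in>{m..<n}. \<Sum>y\<in>(dyadic_block k :: (int ^ 'd) set). lattice_dist 0 y powr - real CARD('d))"
    unfolding J_def
    by (rule sum.UNION_disjoint) (auto simp: card_dyadic_block dest: disjoint_dyadic_block)
  also have "\<dots> \<ge> (\<Sum>k\<in>{m..<n}. (2 * real CARD('d)) powr - real CARD('d))"
    by (intro sum_mono dyadic_block_mass)
  finally show ?thesis
    by simp
qed


section \<open>Conditional probability of a pattern of conditionally independent events\<close>

text \<open>Conditional independence as defined speaks only of intersections of the events themselves.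
  It passes to complements one event at a time, because
  \<open>a * (1 - indicator (A k)) = a - a * indicator (A k)\<close> and conditional expectation is linear;
  keeping a second index set \<open>J\<close> of events that do occur is what makes this induction close.\<close>

lemma (in prob_space) cond_exp_pattern:
  assumes sub: "subalgebra M \<F>"
    and ci: "cond_indep_events M \<F> A I"
    and "finite K" "K \<subseteq> I" "finite J" "J \<subseteq> I" "J \<inter> K = {}"
  shows "AE \<omega> in M.
    real_cond_exp M \<F>
      (\<lambda>\<omega>. (\<Prod>j\<in>J. indicator (A j) \<omega>) * (\<Prod>k\<in>K. 1 - indicator (A k) \<omega>)) \<omega> =
      (\<Prod>j\<in>J. cond_event_prob M \<F> (A j) \<omega>) * (\<Prod>k\<in>K. 1 - cond_event_prob M \<F> (A k) \<omega>)"
  using assms(3-)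
proof (induction K arbitrary: J rule: finite_induct)
  case empty
  interpret finite_measure_subalgebra M \<F>
    by unfold_locales (rule sub)
  show ?case
  proof (cases "J = {}")
    case True
    have "AE \<omega> in M. real_cond_exp M \<F> (\<lambda>_. 1) \<omega> = 1"
      by (rule real_cond_exp_F_meas) auto
    with True show ?thesis
      by simp
  next
    case False
    have "(\<lambda>\<omega>. \<Prod>j\<in>J. indicator (A j) \<omega> :: real) = indicator (\<Inter>j\<in>J. A j)"
      using \<open>finite J\<close> False
      by (induction J rule: finite_ne_induct) (auto simp: fun_eq_iff indicator_inter_arith)
    moreover have "AE \<omega> in M. cond_event_prob M \<F> (\<Inter>j\<in>J. A j) \<omega> =
        (\<Prod>j\<in>J. cond_event_prob M \<F> (A j) \<omega>)"
      using ci False empty by (auto simp: cond_indep_events_def)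
    ultimately show ?thesis
      by (simp add: cond_event_prob_def)
  qed
next
  case (insert k K)
  interpret finite_measure_subalgebra M \<F>
    by unfold_locales (rule sub)
  let ?f = "\<lambda>J K \<omega>. (\<Prod>j\<in>J. indicator (A j) \<omega>) * (\<Prod>k\<in>K. 1 - indicator (A k) \<omega>) :: real"
  have meas: "A i \<in> sets M" if "i \<in> I" for i
    using ci that by (auto simp: cond_indep_events_def)
  have int: "integrable M (?f J' K')" if "J' \<subseteq> I" "K' \<subseteq> I" for J' K'
  proof (rule integrable_const_bound[where B = 1])
    have "\<bar>?f J' K' \<omega>\<bar> \<le> 1 * 1" for \<omega>
      unfolding abs_mult abs_prod
      by (intro mult_mono prod_le_1 prod_nonneg) (auto simp: indicator_def)
    then show "AE \<omega> in M. norm (?f J' K' \<omega>) \<le> 1"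
      by simp
    show "?f J' K' \<in> borel_measurable M"
      using that meas
      by (intro borel_measurable_times borel_measurable_prod borel_measurable_diff
            borel_measurable_const borel_measurable_indicator) auto
  qed
  have "k \<notin> J" and sub_I: "k \<in> I" "K \<subseteq> I" "J \<subseteq> I" "insert k J \<subseteq> I"
    using insert.prems by auto
  have split: "?f J (insert k K) = (\<lambda>\<omega>. ?f J K \<omega> - ?f (insert k J) K \<omega>)"
    using \<open>k \<notin> J\<close> insert.hyps insert.prems by (auto simp: fun_eq_iff algebra_simps)
  have "AE \<omega> in M. real_cond_exp M \<F> (?f J (insert k K)) \<omega> =
      real_cond_exp M \<F> (?f J K) \<omega> - real_cond_exp M \<F> (?f (insert k J) K) \<omega>"
    unfolding split using sub_I by (intro real_cond_exp_diff int)
  moreover have "AE \<omega> in M. real_cond_exp M \<F> (?f J K) \<omega> =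
      (\<Prod>j\<in>J. cond_event_prob M \<F> (A j) \<omega>) * (\<Prod>k\<in>K. 1 - cond_event_prob M \<F> (A k) \<omega>)"
    using insert.prems by (intro insert.IH) auto
  moreover have "AE \<omega> in M. real_cond_exp M \<F> (?f (insert k J) K) \<omega> =
      (\<Prod>j\<in>insert k J. cond_event_prob M \<F> (A j) \<omega>) *
      (\<Prod>k\<in>K. 1 - cond_event_prob M \<F> (A k) \<omega>)"
    using insert.prems insert.hyps by (intro insert.IH) auto
  ultimately show ?case
  proof eventually_elim
    case (elim \<omega>)
    then show ?case
      using \<open>k \<notin> J\<close> insert.hyps insert.prems by (simp add: algebra_simps)
  qed
qed

lemma (in prob_space) prob_none_of_cond_indep:
  assumes sub: "subalgebra M \<F>"
    and ci: "cond_indep_events M \<F> A I"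
    and K: "finite K" "K \<subseteq> I"
    and B: "B \<in> sets \<F>"
  shows "prob (B - (\<Union>k\<in>K. A k)) =
    (\<integral>\<omega>\<in>B. (\<Prod>k\<in>K. 1 - cond_event_prob M \<F> (A k) \<omega>) \<partial>M)"
proof -
  interpret finite_measure_subalgebra M \<F>
    by unfold_locales (rule sub)
  have B': "B \<in> sets M"
    using B sub by (auto simp: subalgebra_def)
  have meas: "A i \<in> sets M" if "i \<in> I" for i
    using ci that by (auto simp: cond_indep_events_def)
  let ?f = "\<lambda>\<omega>. \<Prod>k\<in>K. 1 - indicator (A k) \<omega> :: real"
  have f: "?f \<omega> = indicator (- (\<Union>k\<in>K. A k)) \<omega>" for \<omega>
    using \<open>finite K\<close> by (induction K rule: finite_induct) (auto simp: indicator_def)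
  have f_meas: "?f \<in> borel_measurable M"
    using K meas
    by (intro borel_measurable_prod borel_measurable_diff borel_measurable_const
          borel_measurable_indicator) auto
  have int: "integrable M ?f"
  proof (rule integrable_const_bound[where B = 1])
    show "AE \<omega> in M. norm (?f \<omega>) \<le> 1"
      unfolding f by (simp add: indicator_def)
  qed (rule f_meas)
  have "prob (B - (\<Union>k\<in>K. A k)) = expectation (indicator (B - (\<Union>k\<in>K. A k)))"
    using sets.sets_into_space[OF B'] by (simp add: Int_absorb2 subset_iff)
  also have "\<dots> = (\<integral>\<omega>\<in>B. ?f \<omega> \<partial>M)"
    unfolding set_lebesgue_integral_def f
    by (intro Bochner_Integration.integral_cong) (auto simp: indicator_def)
  also have "\<dots> = (\<integral>\<omega>\<in>B. real_cond_exp M \<F> ?f \<omega> \<partial>M)"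
    by (rule real_cond_exp_intA[OF int B])
  also have "\<dots> = (\<integral>\<omega>\<in>B. (\<Prod>k\<in>K. 1 - cond_event_prob M \<F> (A k) \<omega>) \<partial>M)"
    unfolding set_lebesgue_integral_def
  proof (rule integral_cong_AE)
    show "AE \<omega> in M. indicat_real B \<omega> *\<^sub>R real_cond_exp M \<F> ?f \<omega> =
        indicat_real B \<omega> *\<^sub>R (\<Prod>k\<in>K. 1 - cond_event_prob M \<F> (A k) \<omega>)"
      using cond_exp_pattern[OF sub ci K, of "{}"] by auto
  qed (use B' in \<open>auto simp: cond_event_prob_def\<close>)
  finally show ?thesis .
qed


section \<open>Laplace transforms of the weights\<close>

text \<open>Bounding \<open>exp (- t * X)\<close> by \<open>1\<close> where \<open>X \<le> w\<close> and by \<open>exp (- t * w)\<close> elsewhere turns a lower bound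
  on a single tail probability into an upper bound on the Laplace transform.\<close>

lemma (in prob_space) laplace_le_tail:
  fixes X :: "'a \<Rightarrow> real"
  assumes [measurable]: "random_variable borel X"
    and nn: "AE \<omega> in M. 0 \<le> X \<omega>" and "0 \<le> t"
  shows "expectation (\<lambda>\<omega>. exp (- (t * X \<omega>))) \<le> 1 - (1 - exp (- (t * w))) * \<P>(\<omega> in M. w < X \<omega>)"
proof -
  let ?A = "{\<omega> \<in> space M. w < X \<omega>}"
  have int_A: "integrable M (indicat_real ?A)"
    by (intro integrable_real_indicator) (auto simp: less_top[symmetric])
  have "expectation (\<lambda>\<omega>. exp (- (t * X \<omega>)))
      \<le> expectation (\<lambda>\<omega>. 1 - (1 - exp (- (t * w))) * indicator ?A \<omega>)"
  proof (rule integral_mono_AE)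
    show "integrable M (\<lambda>\<omega>. exp (- (t * X \<omega>)))"
      by (rule integrable_const_bound[where B = 1]) (use nn \<open>0 \<le> t\<close> in auto)
    show "integrable M (\<lambda>\<omega>. 1 - (1 - exp (- (t * w))) * indicator ?A \<omega>)"
      using int_A by (intro Bochner_Integration.integrable_diff integrable_mult_right) auto
    show "AE \<omega> in M. exp (- (t * X \<omega>)) \<le> 1 - (1 - exp (- (t * w))) * indicator ?A \<omega>"
      using nn \<open>0 \<le> t\<close> by (auto simp: indicator_def intro!: mult_left_mono)
  qed
  also have "\<dots> = 1 - (1 - exp (- (t * w))) * prob ?A"
    using int_A by (subst Bochner_Integration.integral_diff) (auto simp: prob_space)
  finally show ?thesis .
qed

lemma (in prob_space) prob_greater_eq_cdf:
  fixes X :: "'a \<Rightarrow> real"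
  assumes [measurable]: "random_variable borel X"
  shows "\<P>(\<omega> in M. w < X \<omega>) = 1 - cdf (distr M borel X) w"
proof -
  have "cdf (distr M borel X) w = prob {\<omega> \<in> space M. X \<omega> \<le> w}"
    by (auto simp: cdf_def measure_distr intro!: arg_cong[where f = prob])
  moreover have "\<P>(\<omega> in M. \<not> X \<omega> \<le> w) = 1 - \<P>(\<omega> in M. X \<omega> \<le> w)"
    by (rule prob_neg) measurable
  ultimately show ?thesis
    by (simp add: not_le)
qed

lemma one_minus_exp_ge:
  fixes u a :: real
  assumes "0 \<le> u" "u \<le> a"
  shows "u / (1 + a) \<le> 1 - exp (- u)"
proof -
  have "exp (- u) \<le> inverse (1 + u)"
    unfolding exp_minus using assms by (intro le_imp_inverse_le exp_ge_add_one_self) auto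
  then have "u / (1 + u) \<le> 1 - exp (- u)"
    using assms by (auto simp: field_simps)
  moreover have "u / (1 + a) \<le> u / (1 + u)"
    using assms by (intro divide_left_mono) auto
  ultimately show ?thesis
    by simp
qed

text \<open>The regimes differ only in the threshold \<open>w\<close> at which the tail is evaluated: a fixed \<open>\<epsilon>\<close> with
  positive tail probability when \<open>\<alpha> \<le> d\<close>, and \<open>|y| powr \<alpha>\<close>, which exactly offsets the distance
  in the exponent, when the tail is heavy.\<close>

lemma (in prob_space) laplace_lattice_bound:
  fixes W :: "int ^ 'd \<Rightarrow> 'a \<Rightarrow> real"
  assumes meas: "\<And>x. random_variable borel (W x)"
    and F: "\<And>x. cdf (distr M borel (W x)) = F"
    and nn: "\<And>x. AE \<omega> in M. W x \<omega> \<ge> 0"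
    and pos: "\<P>(\<omega> in M. W 0 \<omega> > 0) > 0"
    and "\<alpha> > 0" "s > 0"
    and cases: "\<alpha> \<le> real CARD('d) \<or>
         (\<exists>c \<tau>. c > 0 \<and>
             (\<forall>w\<ge>1. 1 - F w \<ge> c * w powr (- (\<tau> - 1))) \<and>
             \<alpha> * (\<tau> - 1) / real CARD('d) \<le> 1)"
  shows "\<exists>\<kappa>>0. \<forall>y. y \<noteq> 0 \<longrightarrow>
    expectation (\<lambda>\<omega>. exp (- (s * W y \<omega> / lattice_dist 0 y powr \<alpha>)))
      \<le> exp (- (\<kappa> * lattice_dist 0 y powr - real CARD('d)))"
proof -
  let ?d = "real CARD('d)"
  let ?r = "\<lambda>y :: int ^ 'd. lattice_dist 0 y"
  have tail: "\<P>(\<omega> in M. w < W x \<omega>) = 1 - F w" for x w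
    using prob_greater_eq_cdf[OF meas] F by simp
  have laplace: "expectation (\<lambda>\<omega>. exp (- (s * W y \<omega> / ?r y powr \<alpha>)))
      \<le> 1 - (1 - exp (- (s * w / ?r y powr \<alpha>))) * (1 - F w)" for y w
    using laplace_le_tail[OF meas nn, of "s / ?r y powr \<alpha>" y w] \<open>s > 0\<close>
    by (simp add: tail)
  have "\<exists>\<kappa>>0. \<forall>y. y \<noteq> 0 \<longrightarrow>
      (\<exists>w. \<kappa> * ?r y powr - ?d \<le> (1 - exp (- (s * w / ?r y powr \<alpha>))) * (1 - F w))"
    using cases
  proof (elim disjE exE conjE)
    assume "\<alpha> \<le> ?d"
    have "\<exists>i. 0 < \<P>(\<omega> in M. inverse (real (Suc i)) < W 0 \<omega>)"
    proof (rule ccontr)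
      assume "\<not> ?thesis"
      then have "\<P>(\<omega> in M. inverse (real (Suc i)) < W 0 \<omega>) = 0" for i
        by (metis measure_nonneg less_le)
      then have "AE \<omega> in M. \<not> inverse (real (Suc i)) < W 0 \<omega>" for i
        using meas[of 0] by (subst (asm) prob_eq_0) (auto simp: AE_conj_iff)
      then have "AE \<omega> in M. \<forall>i. \<not> inverse (real (Suc i)) < W 0 \<omega>"
        by (simp add: AE_all_countable)
      then have "AE \<omega> in M. \<not> 0 < W 0 \<omega>"
        by eventually_elim (metis reals_Archimedean)
      then have "\<P>(\<omega> in M. 0 < W 0 \<omega>) = 0"
        using meas[of 0] by (subst prob_eq_0) auto
      with pos show False
        by simp
    qed
    then obtain \<epsilon> where \<epsilon>: "\<epsilon> > 0" "0 < 1 - F \<epsilon>"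
      unfolding tail by (metis inverse_positive_iff_positive of_nat_0_less_iff zero_less_Suc)
    \<comment> \<open>From \<open>one_minus_exp_ge\<close> with \<open>a = s * \<epsilon>\<close>, an upper bound for \<open>s * \<epsilon> / |y| powr \<alpha>\<close> as \<open>|y| \<ge> 1\<close>.\<close>
    define \<kappa> where "\<kappa> = s * \<epsilon> / (1 + s * \<epsilon>) * (1 - F \<epsilon>)"
    have "\<kappa> > 0"
      using \<epsilon> \<open>s > 0\<close> by (auto simp: \<kappa>_def intro!: mult_pos_pos divide_pos_pos add_pos_pos)
    moreover have "\<kappa> * ?r y powr - ?d \<le> (1 - exp (- (s * \<epsilon> / ?r y powr \<alpha>))) * (1 - F \<epsilon>)"
      if "y \<noteq> 0" for y
    proof -
      have r: "1 \<le> ?r y"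
        using that by (rule one_le_lattice_dist_zero)
      have "s * \<epsilon> / (1 + s * \<epsilon>) * ?r y powr - ?d \<le> s * \<epsilon> / (1 + s * \<epsilon>) * ?r y powr - \<alpha>"
        using r \<epsilon> \<open>s > 0\<close> \<open>\<alpha> \<le> ?d\<close> by (intro mult_left_mono powr_mono) auto
      also have "\<dots> = s * \<epsilon> / ?r y powr \<alpha> / (1 + s * \<epsilon>)"
        by (simp add: powr_minus field_simps)
      also have "\<dots> \<le> 1 - exp (- (s * \<epsilon> / ?r y powr \<alpha>))"
      proof (rule one_minus_exp_ge)
        have "1 \<le> ?r y powr \<alpha>"
          using r \<open>\<alpha> > 0\<close> by (simp add: ge_one_powr_ge_zero)
        then show "s * \<epsilon> / ?r y powr \<alpha> \<le> s * \<epsilon>"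
          using \<epsilon> \<open>s > 0\<close> by (simp add: divide_le_eq mult_left_le)
        show "0 \<le> s * \<epsilon> / ?r y powr \<alpha>"
          using \<epsilon> \<open>s > 0\<close> by simp
      qed
      finally have "s * \<epsilon> / (1 + s * \<epsilon>) * ?r y powr - ?d * (1 - F \<epsilon>)
          \<le> (1 - exp (- (s * \<epsilon> / ?r y powr \<alpha>))) * (1 - F \<epsilon>)"
        using \<epsilon> by (intro mult_right_mono) auto
      then show ?thesis
        by (simp only: \<kappa>_def mult_ac)
    qed
    ultimately show ?thesis
      by blast
  next
    fix c \<tau> :: real
    assume c: "c > 0" and hyp: "\<forall>w\<ge>1. 1 - F w \<ge> c * w powr (- (\<tau> - 1))"
      and \<gamma>: "\<alpha> * (\<tau> - 1) / ?d \<le> 1"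
    have e: "0 < 1 - exp (- s)"
      using \<open>s > 0\<close> by simp
    have "((1 - exp (- s)) * c) * ?r y powr - ?d
        \<le> (1 - exp (- (s * ?r y powr \<alpha> / ?r y powr \<alpha>))) * (1 - F (?r y powr \<alpha>))"
      if "y \<noteq> 0" for y
    proof -
      have r: "1 \<le> ?r y"
        using that by (rule one_le_lattice_dist_zero)
      have "?r y powr - ?d \<le> ?r y powr (\<alpha> * - (\<tau> - 1))"
        using r \<gamma> by (intro powr_mono) (auto simp: field_simps)
      then have "c * ?r y powr - ?d \<le> c * (?r y powr \<alpha>) powr - (\<tau> - 1)"
        using c by (simp add: powr_powr)
      also have "\<dots> \<le> 1 - F (?r y powr \<alpha>)"
        using hyp r \<open>\<alpha> > 0\<close> by (simp add: ge_one_powr_ge_zero)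
      finally have "(1 - exp (- s)) * (c * ?r y powr - ?d) \<le> (1 - exp (- s)) * (1 - F (?r y powr \<alpha>))"
        using e by (intro mult_left_mono) auto
      then show ?thesis
        using r by (simp add: mult.assoc)
    qed
    then show ?thesis
      using c e mult_pos_pos[OF e c] by blast
  qed
  then obtain \<kappa> where \<kappa>: "\<kappa> > 0" "\<And>y. y \<noteq> 0 \<Longrightarrow>
      \<exists>w. \<kappa> * ?r y powr - ?d \<le> (1 - exp (- (s * w / ?r y powr \<alpha>))) * (1 - F w)"
    by blast
  have "expectation (\<lambda>\<omega>. exp (- (s * W y \<omega> / ?r y powr \<alpha>))) \<le> exp (- (\<kappa> * ?r y powr - ?d))"
    if y: "y \<noteq> 0" for y
  proof -
    obtain w where "\<kappa> * ?r y powr - ?d \<le> (1 - exp (- (s * w / ?r y powr \<alpha>))) * (1 - F w)"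
      using \<kappa>(2)[OF y] by blast
    then have "expectation (\<lambda>\<omega>. exp (- (s * W y \<omega> / ?r y powr \<alpha>))) \<le> 1 - \<kappa> * ?r y powr - ?d"
      using laplace[of y w] by linarith
    also have "\<dots> \<le> exp (- (\<kappa> * ?r y powr - ?d))"
      using exp_ge_add_one_self[of "- (\<kappa> * ?r y powr - ?d)"] by simp
    finally show ?thesis .
  qed
  with \<kappa>(1) show ?thesis
    by blast
qed


section \<open>The neighbourhood of the origin\<close>

lemma subalgebra_sigma_generated:
  assumes "\<And>x. W x \<in> borel_measurable M"
  shows "subalgebra M (sigma_generated M W)"
proof -
  have "(\<lambda>\<omega> x. W x \<omega>) \<in> measurable M (\<Pi>\<^sub>M x\<in>UNIV. borel)"
    using assms by (intro measurable_PiM_single') (auto simp: space_PiM)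
  then show ?thesis
    unfolding subalgebra_def sigma_generated_def
    by (auto simp: sets_vimage_algebra2 space_PiM dest: measurable_sets)
qed

lemma measurable_sigma_generated:
  "W x \<in> borel_measurable (sigma_generated M W)"
proof -
  have "(\<lambda>\<omega> x. W x \<omega>) \<in> measurable (sigma_generated M W) (\<Pi>\<^sub>M x\<in>UNIV. borel)"
    unfolding sigma_generated_def by (rule measurable_vimage_algebra1) (auto simp: space_PiM)
  moreover have "(\<lambda>f. f x) \<in> measurable (\<Pi>\<^sub>M x\<in>UNIV. borel) borel"
    by (rule measurable_component_singleton) simp
  ultimately have "(\<lambda>f. f x) \<circ> (\<lambda>\<omega> x. W x \<omega>) \<in> borel_measurable (sigma_generated M W)"
    by (rule measurable_comp)
  then show ?thesis
    by (simp add: comp_def)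
qed

lemma edge_event_measurable:
  assumes "scale_free_percolation M W G \<alpha> lam" "x \<noteq> y"
  shows "{\<omega> \<in> space M. {x, y} \<in> G \<omega>} \<in> sets M"
proof -
  have "{x, y} \<in> potential_edges"
    using assms(2) by (auto simp: potential_edges_def)
  then show ?thesis
    using assms(1) unfolding scale_free_percolation_def cond_indep_events_def by blast
qed

text \<open>Replacing \<open>W 0\<close> by its lower bound \<open>\<delta>\<close> leaves an integrand that depends only on the weights in
  \<open>J\<close>, and their independence makes its expectation factorize.\<close>

lemma (in prob_space) prob_no_edge_le:
  fixes W :: "int ^ 'd \<Rightarrow> 'a \<Rightarrow> real"
  assumes indep: "indep_vars (\<lambda>x. borel) W UNIV"
    and nn: "\<And>x. AE \<omega> in M. W x \<omega> \<ge> 0"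
    and sfp: "scale_free_percolation M W G \<alpha> lam"
    and "lam > 0" "\<delta> > 0"
    and J: "finite J" "0 \<notin> J"
  shows "\<P>(\<omega> in M. \<delta> \<le> W 0 \<omega> \<and> (\<forall>y\<in>J. {0, y} \<notin> G \<omega>))
    \<le> (\<Prod>y\<in>J. expectation (\<lambda>\<omega>. exp (- (lam * \<delta> * W y \<omega> / lattice_dist 0 y powr \<alpha>))))"
proof -
  let ?F = "sigma_generated M W"
  let ?E = "\<lambda>e. {\<omega> \<in> space M. e \<in> G \<omega>}"
  let ?r = "\<lambda>y. lattice_dist 0 y powr \<alpha>"
  let ?B = "{\<omega> \<in> space M. \<delta> \<le> W 0 \<omega>}"
  let ?h = "\<lambda>y \<omega>. exp (- (lam * \<delta> * W y \<omega> / ?r y))"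
  have meas [measurable]: "random_variable borel (W x)" for x
    using indep by (auto simp: indep_vars_def)
  have B: "?B \<in> sets ?F"
    using measurable_sets[OF measurable_sigma_generated[of W 0 M], of "{\<delta>..}"]
    by (simp add: vimage_def Int_def conj_commute sigma_generated_def)
  have ci: "cond_indep_events M ?F ?E potential_edges"
    using sfp by (simp add: scale_free_percolation_def)
  have K: "finite ((\<lambda>y. {0, y}) ` J)" "(\<lambda>y. {0, y}) ` J \<subseteq> potential_edges"
    using J by (auto simp: potential_edges_def)
  have inj: "inj_on (\<lambda>y. {0, y}) J"
    using J by (auto simp: inj_on_def doubleton_eq_iff)
  have edge: "AE \<omega> in M. \<forall>y\<in>J. 1 - cond_event_prob M ?F (?E {0, y}) \<omega> =
      exp (- (lam * W 0 \<omega> * W y \<omega> / ?r y))"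
  proof (rule AE_finite_allI[OF J(1)])
    fix y assume "y \<in> J"
    then have "0 \<noteq> y"
      using J by auto
    then have "AE \<omega> in M. cond_event_prob M ?F (?E {0, y}) \<omega> =
        1 - exp (- (lam * W 0 \<omega> * W y \<omega> / ?r y))"
      using sfp unfolding scale_free_percolation_def by blast
    then show "AE \<omega> in M. 1 - cond_event_prob M ?F (?E {0, y}) \<omega> =
        exp (- (lam * W 0 \<omega> * W y \<omega> / ?r y))"
      by eventually_elim simp
  qed
  have nn': "AE \<omega> in M. \<forall>y\<in>J. 0 \<le> W y \<omega>"
    using J nn by (intro AE_finite_allI) auto
  have indep_h: "indep_vars (\<lambda>_. borel) ?h J"
    using indep_vars_subset[OF indep, of J]
    by (rule indep_vars_compose2) auto
  have int_h: "integrable M (?h y)" if "y \<in> J" for y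
  proof (rule integrable_const_bound[where B = 1])
    show "AE \<omega> in M. norm (?h y \<omega>) \<le> 1"
      using nn[of y] \<open>lam > 0\<close> \<open>\<delta> > 0\<close> by (auto intro!: divide_nonneg_nonneg mult_nonneg_nonneg)
  qed auto
  have "{\<omega> \<in> space M. \<delta> \<le> W 0 \<omega> \<and> (\<forall>y\<in>J. {0, y} \<notin> G \<omega>)} = ?B - (\<Union>e\<in>(\<lambda>y. {0, y}) ` J. ?E e)"
    by auto
  then have "\<P>(\<omega> in M. \<delta> \<le> W 0 \<omega> \<and> (\<forall>y\<in>J. {0, y} \<notin> G \<omega>)) =
      (\<integral>\<omega>\<in>?B. (\<Prod>e\<in>(\<lambda>y. {0, y}) ` J. 1 - cond_event_prob M ?F (?E e) \<omega>) \<partial>M)"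
    using prob_none_of_cond_indep[OF subalgebra_sigma_generated[of W M, OF meas] ci K B] by simp
  also have "\<dots> = (\<integral>\<omega>. indicator ?B \<omega> * (\<Prod>y\<in>J. 1 - cond_event_prob M ?F (?E {0, y}) \<omega>) \<partial>M)"
    by (simp add: set_lebesgue_integral_def prod.reindex[OF inj])
  also have "\<dots> \<le> (\<integral>\<omega>. (\<Prod>y\<in>J. ?h y \<omega>) \<partial>M)"
  proof (rule integral_mono_AE')
    show "integrable M (\<lambda>\<omega>. \<Prod>y\<in>J. ?h y \<omega>)"
      using J(1) indep_h int_h by (rule indep_vars_integrable)
    show "AE \<omega> in M. 0 \<le> (\<Prod>y\<in>J. ?h y \<omega>)"
      by (auto intro!: prod_nonneg)
    show "AE \<omega> in M. indicator ?B \<omega> * (\<Prod>y\<in>J. 1 - cond_event_prob M ?F (?E {0, y}) \<omega>)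
        \<le> (\<Prod>y\<in>J. ?h y \<omega>)"
      using edge nn'
    proof eventually_elim
      case (elim \<omega>)
      show ?case
      proof (cases "\<omega> \<in> ?B")
        case True
        have "(\<Prod>y\<in>J. 1 - cond_event_prob M ?F (?E {0, y}) \<omega>) =
            (\<Prod>y\<in>J. exp (- (lam * W 0 \<omega> * W y \<omega> / ?r y)))"
          using elim by (intro prod.cong) auto
        also have "\<dots> \<le> (\<Prod>y\<in>J. ?h y \<omega>)"
          using True elim \<open>lam > 0\<close>
          by (intro prod_mono) (auto intro!: divide_right_mono mult_right_mono mult_left_mono)
        finally show ?thesis
          using True by simp
      qed (auto intro!: prod_nonneg)
    qed
  qed
  also have "\<dots> = (\<Prod>y\<in>J. expectation (?h y))"
    using J(1) indep_h int_h by (rule indep_vars_lebesgue_integral)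
  finally show ?thesis .
qed

lemma vertex_degree_eq_infinity_iff:
  "vertex_degree E x = \<infinity> \<longleftrightarrow> infinite {y. y \<noteq> x \<and> {x, y} \<in> E}"
  by (simp add: vertex_degree_def Let_def)

text \<open>A set of vertices is infinite iff no finite set contains it.  A countable type has only countably
  many finite subsets, so the event is a countable combination of edge events.\<close>

lemma measurable_vertex_degree_infinite:
  fixes G :: "'a \<Rightarrow> ('v :: countable) set set"
  assumes "\<And>y. y \<noteq> x \<Longrightarrow> {\<omega> \<in> space M. {x, y} \<in> G \<omega>} \<in> sets M"
  shows "{\<omega> \<in> space M. vertex_degree (G \<omega>) x = \<infinity>} \<in> sets M"
proof -
  have "infinite N \<longleftrightarrow> (\<forall>K\<in>{K. finite K}. \<exists>y. y \<in> N - K)" for N :: "'v set"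
    by (metis Diff_cancel Diff_infinite_finite all_not_in_conv finite.emptyI mem_Collect_eq)
  then have "{\<omega> \<in> space M. vertex_degree (G \<omega>) x = \<infinity>} =
      {\<omega> \<in> space M. \<forall>K\<in>{K. finite K}. \<exists>y\<in>- K - {x}. {x, y} \<in> G \<omega>}"
    unfolding vertex_degree_eq_infinity_iff by (auto simp: Bex_def)
  also have "\<dots> \<in> sets M"
    using assms
    by (intro sets.sets_Collect_countable_All' sets.sets_Collect_countable_Ex'
          countable_Collect_finite countableI_type) auto
  finally show ?thesis .
qed

text \<open>Working with whole tails of blocks, instead of the complement of an arbitrary finite set, leaves only
  countably many null events to discard.  A vertex that has neighbours in infinitely many of the
  disjoint blocks has infinite degree.\<close>

lemma (in prob_space) AE_infinite_degree:
  fixes W :: "int ^ 'd \<Rightarrow> 'a \<Rightarrow> real"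
  assumes indep: "indep_vars (\<lambda>x. borel) W UNIV"
    and nn: "\<And>x. AE \<omega> in M. W x \<omega> \<ge> 0"
    and sfp: "scale_free_percolation M W G \<alpha> lam"
    and "lam > 0"
    and decay: "\<And>s. s > 0 \<Longrightarrow> \<exists>\<kappa>>0. \<forall>y. y \<noteq> 0 \<longrightarrow>
      expectation (\<lambda>\<omega>. exp (- (s * W y \<omega> / lattice_dist 0 y powr \<alpha>)))
        \<le> exp (- (\<kappa> * lattice_dist 0 y powr - real CARD('d)))"
  shows "AE \<omega> in M. 0 < W 0 \<omega> \<longrightarrow> vertex_degree (G \<omega>) 0 = \<infinity>"
proof -
  let ?J = "\<lambda>m n. \<Union>k\<in>{m..<n}. dyadic_block k :: (int ^ 'd) set"
  have meas [measurable]: "random_variable borel (W x)" for x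
    using indep by (auto simp: indep_vars_def)
  note edge_meas = edge_event_measurable[OF sfp]
  have null: "AE \<omega> in M. \<not> (\<delta> \<le> W 0 \<omega> \<and> (\<forall>k\<ge>m. \<forall>y\<in>dyadic_block k. {0, y} \<notin> G \<omega>))"
    if "\<delta> > 0" for \<delta> m
  proof -
    let ?N = "{\<omega> \<in> space M. \<delta> \<le> W 0 \<omega> \<and> (\<forall>k\<in>{m..}. \<forall>y\<in>dyadic_block k. {0, y} \<notin> G \<omega>)}"
    obtain \<kappa> where \<kappa>: "\<kappa> > 0" "\<And>y. y \<noteq> 0 \<Longrightarrow>
        expectation (\<lambda>\<omega>. exp (- (lam * \<delta> * W y \<omega> / lattice_dist 0 y powr \<alpha>)))
          \<le> exp (- (\<kappa> * lattice_dist 0 y powr - real CARD('d)))"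
      using decay[of "lam * \<delta>"] \<open>lam > 0\<close> \<open>\<delta> > 0\<close> by auto
    define b where "b = \<kappa> * (2 * real CARD('d)) powr - real CARD('d)"
    have "b > 0"
      using \<kappa>(1) by (simp add: b_def)
    have block_meas: "{\<omega> \<in> space M. {0, y} \<notin> G \<omega>} \<in> sets M" if "y \<in> dyadic_block k" for y k
    proof -
      have "0 \<noteq> y"
        using that zero_notin_dyadic_block[of k] by auto
      then show ?thesis
        by (intro sets.sets_Collect_neg edge_meas)
    qed
    have bound: "prob ?N \<le> exp (- (b * real n))" for n
    proof -
      have J: "finite (?J m (m + n))" "0 \<notin> ?J m (m + n)"
        by (auto simp: card_dyadic_block zero_notin_dyadic_block)
      have "prob ?N \<le> \<P>(\<omega> in M. \<delta> \<le> W 0 \<omega> \<and> (\<forall>y\<in>?J m (m + n). {0, y} \<notin> G \<omega>))"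
      proof (rule finite_measure_mono)
        show "{\<omega> \<in> space M. \<delta> \<le> W 0 \<omega> \<and> (\<forall>y\<in>?J m (m + n). {0, y} \<notin> G \<omega>)} \<in> sets M"
          using J block_meas
          by (intro sets.sets_Collect_conj sets.sets_Collect_finite_All) auto
      qed auto
      also have "\<dots> \<le> (\<Prod>y\<in>?J m (m + n).
          expectation (\<lambda>\<omega>. exp (- (lam * \<delta> * W y \<omega> / lattice_dist 0 y powr \<alpha>))))"
        using prob_no_edge_le[OF indep nn sfp \<open>lam > 0\<close> \<open>\<delta> > 0\<close> J] .
      also have "\<dots> \<le> (\<Prod>y\<in>?J m (m + n). exp (- (\<kappa> * lattice_dist 0 y powr - real CARD('d))))"
        using J by (intro prod_mono conjI \<kappa>(2) integral_nonneg_AE) auto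
      also have "\<dots> = exp (- (\<kappa> * (\<Sum>y\<in>?J m (m + n). lattice_dist 0 y powr - real CARD('d))))"
        using J(1) by (simp add: exp_sum[symmetric] sum_negf sum_distrib_left)
      also have "\<dots> \<le> exp (- (b * real n))"
        using mult_left_mono[OF dyadic_blocks_mass[of "m + n" m, where 'd = 'd], of \<kappa>] \<kappa>(1)
        by (simp add: b_def mult_ac)
      finally show ?thesis .
    qed
    have "(\<lambda>n. exp (- (b * real n))) \<longlonglongrightarrow> 0"
      using \<open>b > 0\<close> by real_asymp
    then have "prob ?N \<le> 0"
      by (rule LIMSEQ_le_const) (intro exI allI impI bound)
    then have "prob ?N = 0"
      by (simp add: measure_le_0_iff)
    moreover have "?N \<in> sets M"
    proof (rule sets.sets_Collect_conj)
      show "{\<omega> \<in> space M. \<forall>k\<in>{m..}. \<forall>y\<in>dyadic_block k. {0, y} \<notin> G \<omega>} \<in> sets M"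
        by (rule sets.sets_Collect_countable_All', rule sets.sets_Collect_countable_All',
            erule block_meas) (rule countableI_type)+
    qed measurable
    ultimately have "AE \<omega> in M. \<omega> \<notin> ?N"
      by (simp only: prob_eq_0)
    then show ?thesis
      using AE_space by eventually_elim blast
  qed
  have "AE \<omega> in M. \<forall>m i. \<not> (inverse (real (Suc i)) \<le> W 0 \<omega> \<and>
      (\<forall>k\<ge>m. \<forall>y\<in>dyadic_block k. {0, y} \<notin> G \<omega>))"
    unfolding AE_all_countable by (intro allI null) simp
  then show ?thesis
  proof eventually_elim
    case (elim \<omega>)
    show ?case
    proof
      assume "0 < W 0 \<omega>"
      then obtain i where i: "inverse (real (Suc i)) \<le> W 0 \<omega>"
        using reals_Archimedean less_imp_le by blast
      define N where "N = {y. y \<noteq> 0 \<and> {0, y} \<in> G \<omega>}"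
      define K where "K = {k. \<exists>y\<in>dyadic_block k. y \<in> N}"
      have "\<exists>k\<ge>m. k \<in> K" for m
      proof -
        obtain k y where k: "m \<le> k" "y \<in> dyadic_block k" "{0, y} \<in> G \<omega>"
          using elim[rule_format, of i m] i by blast
        then have "y \<noteq> 0"
          using zero_notin_dyadic_block[of k] by auto
        with k show ?thesis
          unfolding K_def N_def by blast
      qed
      then have "infinite K"
        by (simp add: infinite_nat_iff_unbounded_le)
      have "\<forall>k\<in>K. \<exists>y. y \<in> dyadic_block k \<inter> N"
        by (auto simp: K_def)
      then obtain g where g: "\<And>k. k \<in> K \<Longrightarrow> g k \<in> dyadic_block k \<inter> N"
        by (auto dest!: bchoice)
      then have "inj_on g K"
        by (intro inj_onI) (metis IntD1 IntI disjoint_dyadic_block empty_iff)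
      moreover have "g ` K \<subseteq> N"
        using g by auto
      ultimately have "infinite N"
        using \<open>infinite K\<close> finite_imageD finite_subset by blast
      then show "vertex_degree (G \<omega>) 0 = \<infinity>"
        by (simp add: vertex_degree_eq_infinity_iff N_def)
    qed
  qed
qed


section \<open>Infinite degree at a vertex of positive weight\<close>


theorem theorem2p1:
  fixes M :: "'a measure"
    and W :: "int ^ 'd \<Rightarrow> 'a \<Rightarrow> real"
    and F :: "real \<Rightarrow> real"
    and G :: "'a \<Rightarrow> (int ^ 'd) set set"
    and \<alpha> lam :: real
  assumes "prob_space M"
    and "\<alpha> > 0" and "lam > 0"
    and "prob_space.indep_vars M (\<lambda>x. borel) W UNIV"
    and "\<And>x. cdf (distr M borel (W x)) = F"
    and "\<And>x. AE \<omega> in M. W x \<omega> \<ge> 0"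
    and "\<P>(\<omega> in M. W 0 \<omega> > 0) > 0"
    and "scale_free_percolation M W G \<alpha> lam"
    and "\<alpha> \<le> real CARD('d) \<or>
         (\<alpha> > real CARD('d) \<and>
          (\<exists>c \<tau>. c > 0 \<and> \<tau> > 1 \<and>
             (\<forall>w\<ge>1. 1 - F w \<ge> c * w powr (- (\<tau> - 1))) \<and>
             \<alpha> * (\<tau> - 1) / real CARD('d) \<le> 1))"
  shows "\<P>(\<omega> in M. vertex_degree (G \<omega>) 0 = \<infinity> \<bar> W 0 \<omega> > 0) = 1"
proof -
  interpret prob_space M
    by fact
  have meas [measurable]: "random_variable borel (W x)" for x
    using assms(4) by (auto simp: indep_vars_def)
  have decay: "\<exists>\<kappa>>0. \<forall>y. y \<noteq> 0 \<longrightarrow>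
      expectation (\<lambda>\<omega>. exp (- (s * W y \<omega> / lattice_dist 0 y powr \<alpha>)))
        \<le> exp (- (\<kappa> * lattice_dist 0 y powr - real CARD('d)))" if "s > 0" for s
    by (rule laplace_lattice_bound[where F = F])
       (use assms that meas in \<open>blast+\<close>)
  have ae: "AE \<omega> in M. 0 < W 0 \<omega> \<longrightarrow> vertex_degree (G \<omega>) 0 = \<infinity>"
    using assms(4,6,8,3) decay by (rule AE_infinite_degree)
  have "{\<omega> \<in> space M. vertex_degree (G \<omega>) 0 = \<infinity>} \<in> sets M"
    using edge_event_measurable[OF assms(8)]
    by (intro measurable_vertex_degree_infinite) metis
  then have "\<P>(\<omega> in M. vertex_degree (G \<omega>) 0 = \<infinity> \<and> W 0 \<omega> > 0) = \<P>(\<omega> in M. W 0 \<omega> > 0)"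
    using ae by (intro prob_eq_AE sets.sets_Collect_conj) auto
  then show ?thesis
    using assms(7) by (simp add: cond_prob_def)
qed

end
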